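(* Let $M_i,L_i\ge 0$ with $M_i+L_i>0$ for all $1\le i\le n$. Suppose that for every $1\le i\le n$ the operator $Q_i$ is monotone and $M_i$-Lipschitz on $\mathcal Z$ with respect to $\|\cdot\|_{\mathbf P}$, and that the convex function $p_i$ is equipped with a first-order $(\delta_i,L_i)$-oracle on $\mathcal Z$ with respect to $\|\cdot\|_{\mathbf P}$. Let $T_1,\dots,T_n$ be positive integers. Run the Sliding Algorithm (described in the context) from $z_{\mathrm{in}}\in\mathcal Z$ with $$\alpha_0=1,\qquad \alpha_{t+1}=\frac{2}{1+\sqrt{1+4/\alpha_t^2}},\quad t\ge 0,$$ and $$\eta_{\mathbf t}^{k}=L_k\prod_{\ell=1}^k\alpha_{t_\ell}+M_k\prod_{\ell=1}^k\frac{\alpha_{t_\ell}}{\alpha_{T_\ell-1}},\qquad \mathbf t=(t_1,\dots,t_k),$$ for every $1\le k\le n$ and $0\le t_\ell\le T_\ell-1$. Then, for every $z\in\mathcal Z$, the output $z_{\mathrm{out}}$ satisfies $$p(z_{\mathrm{out}})-p(z)+\langle Q(z),z_{\mathrm{out}}-z\rangle\le\sum_{i=1}^n\left[\frac{2^{2i-1}L_i}{\prod_{j=1}^iT_j^2}\|z_{\mathrm{in}}-z\|_{\mathbf P}^2+\frac{2^{i-1}M_i}{\prod_{j=1}^iT_j}\|z_{\mathrm{in}}-z\|_{\mathbf P}^2+\delta_i\prod_{j=1}^iT_j\right].$$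
   Context: Setting. $\mathcal Z\subseteq\mathbb R^{d_z}$ is nonempty, closed and convex; $p=\sum_{i=1}^np_i$ and $Q=\sum_{i=1}^nQ_i$, where each $p_i:\mathcal Z\to\mathbb R$ is convex and each $Q_i:\mathcal Z\to\mathbb R^{d_z}$ is continuous and monotone. $\mathbf P$ is a symmetric positive definite matrix, $\|z\|_{\mathbf P}=\langle\mathbf Pz,z\rangle^{1/2}$ and $\|s\|_{\mathbf P^{-1}}=\langle\mathbf P^{-1}s,s\rangle^{1/2}$. An operator $G$ is monotone if $\langle G(u)-G(v),u-v\rangle\ge0$, and $M$-Lipschitz with respect to $\|\cdot\|_{\mathbf P}$ if $\|G(u)-G(v)\|_{\mathbf P^{-1}}\le M\|u-v\|_{\mathbf P}$, for all $u,v\in\mathcal Z$. A function $h:\mathcal Z\to\mathbb R$ is equipped with a first-order $(\delta,L)$-oracle with respect to $\|\cdot\|_{\mathbf P}$ if for any $v\in\mathcal Z$ one can compute a pair $(\tilde h(v),\tilde\nabla h(v))$ such that for all $u\in\mathcal Z$, $0\le h(u)-\tilde h(v)-\langle\tilde\nabla h(v),u-v\rangle\le\frac L2\|u-v\|_{\mathbf P}^2+\delta$. Sliding Algorithm. Data: the pairs $(p_i,Q_i)$, $1\le i\le n$, with oracle vectors $\tilde\nabla p_i(\cdot)$; positive integers $T_1,\dots,T_n$; a sequence $(\alpha_t)_{t\ge0}$; numbers $\eta^k_{\mathbf t}>0$ for $1\le k\le n$, $\mathbf t=(t_1,\dots,t_k)$, $0\le t_\ell\le T_\ell-1$; input $z_{\mathrm{in}}\in\mathcal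 Z$. Set $z^k_{(0,\dots,0)}=z_{\mathrm{in}}$ ($k$ zeros) for $k=1,\dots,n$. The output is $z_{\mathrm{out}}=\mathrm{Rec}(0,\varnothing)$, where for $0\le k\le n$ and $\mathbf t=(t_1,\dots,t_k)$ the procedure $\mathrm{Rec}(k,\mathbf t)$ is: (a) If $k=n$, return $\operatorname{argmin}_{z\in\mathcal Z}\sum_{i=1}^n\big\{\langle\tilde\nabla p_i(w^i_{(t_1,\dots,t_i)})+Q_i(z^i_{(t_1,\dots,t_i)}),z\rangle+\tfrac12\eta^i_{(t_1,\dots,t_i)}\|z-z^i_{(t_1,\dots,t_i)}\|_{\mathbf P}^2\big\}$. (b) If $k<n$, set $\bar z^{k+1}_{(\mathbf t,0)}=z^{k+1}_{(\mathbf t,0)}$. For $j=0,\dots,T_{k+1}-1$, with $\mathbf t'=(\mathbf t,j)$ and $\mathbf t''=(\mathbf t,j+1)$: set $\tilde z^{k+1}_{\mathbf t'}=\mathrm{Rec}(k+1,\mathbf t')$; $\bar z^{k+1}_{\mathbf t''}=\alpha_j\tilde z^{k+1}_{\mathbf t'}+(1-\alpha_j)\bar z^{k+1}_{\mathbf t'}$; $z^{k+1}_{\mathbf t''}=\operatorname{argmin}_{z\in\mathcal Z}\{\langle Q_{k+1}(\tilde z^{k+1}_{\mathbf t'})-Q_{k+1}(z^{k+1}_{\mathbf t'}),z\rangle+\tfrac12\eta^{k+1}_{\mathbf t'}\|z-\tilde z^{k+1}_{\mathbf t'}\|_{\mathbf P}^2\}$; and, for $\ell=k+2,\dots,n$,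 $z^\ell_{(\mathbf t'',0,\dots,0)}=z^\ell_{(\mathbf t',T_{k+2},0,\dots,0)}$ (padding by zeros to length $\ell$). Return $\bar z^{k+1}_{(\mathbf t,T_{k+1})}$. Here $w^i_{(t_1,\dots,t_i)}=(a_1\circ a_2\circ\cdots\circ a_i)(z^i_{(t_1,\dots,t_i)})$ with $a_\ell(z)=\alpha_{t_\ell}z+(1-\alpha_{t_\ell})\bar z^\ell_{(t_1,\dots,t_\ell)}$; the vectors $\tilde\nabla p_i(w^i_{\mathbf t})$ and $Q_i(z^i_{\mathbf t})$ are computed once per multi-index $\mathbf t$ of length $i$. *)

theory Defs
  imports "HOL-Analysis.Analysis"
begin

definition sym_pos_def :: "real^'d^'d \<Rightarrow> bool" where
  "sym_pos_def P \<longleftrightarrow> transpose P = P \<and> (\<forall>z. z \<noteq> 0 \<longrightarrow> 0 < (P *v z) \<bullet> z)"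

text \<open>The dual norm is \<open>wnorm (matrix_inv P)\<close>.\<close>

definition wnorm :: "real^'d^'d \<Rightarrow> real^'d \<Rightarrow> real" where
  "wnorm P z = sqrt ((P *v z) \<bullet> z)"

definition monotone_operator :: "(real^'d) set \<Rightarrow> (real^'d \<Rightarrow> real^'d) \<Rightarrow> bool" where
  "monotone_operator Z G \<longleftrightarrow> (\<forall>u\<in>Z. \<forall>v\<in>Z. 0 \<le> (G u - G v) \<bullet> (u - v))"

definition lipschitz_operator ::
    "real^'d^'d \<Rightarrow> (real^'d) set \<Rightarrow> real \<Rightarrow> (real^'d \<Rightarrow> real^'d) \<Rightarrow> bool" where
  "lipschitz_operator P Z M G \<longleftrightarrow>
     (\<forall>u\<in>Z. \<forall>v\<in>Z. wnorm (matrix_inv P) (G u - G v) \<le> M * wnorm P (u - v))"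

text \<open>The answer of the oracle at \<open>v\<close> is the pair \<open>(h' v, g v)\<close>.\<close>

definition first_order_oracle ::
    "real^'d^'d \<Rightarrow> (real^'d) set \<Rightarrow> (real^'d \<Rightarrow> real) \<Rightarrow> (real^'d \<Rightarrow> real) \<Rightarrow> (real^'d \<Rightarrow> real^'d)
      \<Rightarrow> real \<Rightarrow> real \<Rightarrow> bool" where
  "first_order_oracle P Z h h' g \<delta> L \<longleftrightarrow>
     (\<forall>v\<in>Z. \<forall>u\<in>Z. 0 \<le> h u - h' v - g v \<bullet> (u - v) \<and>
        h u - h' v - g v \<bullet> (u - v) \<le> L / 2 * (wnorm P (u - v))\<^sup>2 + \<delta>)"

text \<open>
  The data of the Sliding Algorithm: the matrix \<open>P\<close>, the set \<open>Z\<close>, the number \<open>n\<close> of pairs, the oracle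
  vectors for \<open>p\<^sub>i\<close>, the operators \<open>Q\<^sub>i\<close>, the loop lengths \<open>T\<^sub>k\<close>, the sequence \<open>\<alpha>\<close>, the numbers
  \<open>\<eta>\<close> and the input point. A multi-index \<open>(t\<^sub>1, \<dots>, t\<^sub>k)\<close> is the list \<open>t\<close> of length \<open>k\<close> with
  \<open>t\<^sub>l = t ! (l - 1)\<close>, so that \<open>(t\<^sub>1, \<dots>, t\<^sub>l)\<close> is \<open>take l t\<close>, and the level \<open>k\<close> of a variable is the
  length of its index.
\<close>

record ('d::finite) sliding_data =
  weight :: "real^'d^'d"
  feasible :: "(real^'d) set"
  levels :: nat
  grad :: "nat \<Rightarrow> real^'d \<Rightarrow> real^'d"
  oper :: "nat \<Rightarrow> real^'d \<Rightarrow> real^'d"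
  loops :: "nat \<Rightarrow> nat"
  mix :: "nat \<Rightarrow> real"
  reg :: "nat list \<Rightarrow> real"
  input :: "real^'d"

lemma index_cases:
  fixes x :: "nat list"
  obtains (zero) m where "x = replicate m 0"
    | (succ) t j m where "x = t @ [Suc j] @ replicate m 0"
proof (induction x arbitrary: thesis rule: rev_induct)
  case Nil
  show ?case by (rule Nil(1)[of 0]) simp
next
  case (snoc a x)
  show ?case
  proof (cases a)
    case (Suc j)
    show ?thesis by (rule snoc.prems(2)[of x j 0]) (simp add: Suc)
  next
    case 0
    show ?thesis
    proof (rule snoc.IH)
      fix m assume "x = replicate m 0"
      then show ?thesis
        by (intro snoc.prems(1)[of "Suc m"]) (simp add: 0 replicate_append_same)
    next
      fix t j m assume "x = t @ [Suc j] @ replicate m 0"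
      then show ?thesis
        by (intro snoc.prems(2)[of t j "Suc m"]) (simp add: 0 replicate_append_same)
    qed
  qed
qed

lemma index_unique:
  assumes "t @ [Suc j] @ replicate m 0 = t' @ [Suc j'] @ replicate m' (0::nat)"
  shows "t = t' \<and> j = j' \<and> m = m'"
  using assms
proof (induction m arbitrary: m')
  case 0
  then show ?case by (cases m') (auto simp flip: replicate_append_same)
next
  case (Suc m)
  show ?case
  proof (cases m')
    case 0
    then show ?thesis using Suc.prems by (auto simp flip: replicate_append_same)
  next
    case (Suc k)
    have "(t @ [Suc j] @ replicate m 0) @ [0] = (t' @ [Suc j'] @ replicate k 0) @ [0]"
      using Suc.prems by (simp add: Suc replicate_append_same)
    then show ?thesis using Suc.IH[of k] by (simp add: Suc)
  qed
qed

lemma index_nonzero: "t @ [Suc j] @ replicate m 0 \<noteq> replicate k (0::nat)"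
proof
  assume "t @ [Suc j] @ replicate m 0 = replicate k (0::nat)"
  then have "Suc j \<in> set (replicate k (0::nat))"
    by (metis append_Cons in_set_conv_decomp)
  then show False by simp
qed

lemma index_simps:
  "replicate m (0::nat) \<noteq> t @ [Suc j]" "t @ [Suc j] \<noteq> replicate m (0::nat)"
  "replicate m (0::nat) \<noteq> t @ Suc j # 0 # replicate k 0"
  "t @ Suc j # 0 # replicate k 0 \<noteq> replicate m (0::nat)"
  "t @ [Suc j] \<noteq> t' @ Suc j' # (0::nat) # replicate k 0"
  "t' @ Suc j' # (0::nat) # replicate k 0 \<noteq> t @ [Suc j]"
  "t @ Suc j # 0 # replicate k 0 = t' @ Suc j' # (0::nat) # replicate k' 0
     \<longleftrightarrow> t = t' \<and> j = j' \<and> k = k'"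
  using index_nonzero[of t j 0 m] index_nonzero[of t j "Suc k" m]
    index_unique[of t j 0 t' j' "Suc k"] index_unique[of t j "Suc k" t' j' "Suc k'"]
  by (auto simp: eq_commute)

lemma lenlex_same_prefix:
  "(t @ xs, t @ ys) \<in> lenlex less_than \<longleftrightarrow> (xs, ys) \<in> lenlex less_than"
proof (induction t)
  case (Cons a t)
  have "(xs, ys) \<in> lenlex less_than" if "length xs < length ys"
    using that by (simp add: lenlex_conv)
  then show ?case using Cons by (auto simp: Cons_lenlex_iff)
qed simp

lemma lenlex_take:
  assumes "l \<le> length t" "l + k \<le> length t + m" "c \<le> c'" "a < b"
  shows "(take l t @ replicate k 0 @ [c, a], t @ replicate m 0 @ [c', b]) \<in> lenlex less_than"
  using assms
proof (induction t arbitrary: l k)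
  case Nil
  show ?case
  proof (cases "k = m")
    case True
    then show ?thesis using Nil by (auto simp: lenlex_same_prefix Cons_lenlex_iff)
  next
    case False
    then show ?thesis using Nil by (auto simp: lenlex_conv)
  qed
next
  case (Cons x xs)
  show ?case
  proof (cases l)
    case (Suc l')
    then show ?thesis using Cons.IH[of l' k] Cons.prems by (simp add: Cons_lenlex_iff)
  next
    case 0
    show ?thesis
    proof (cases k)
      case 0
      then show ?thesis using Cons.prems \<open>l = 0\<close> by (auto simp: lenlex_conv)
    next
      case (Suc k')
      then show ?thesis using Cons.IH[of 0 k'] Cons.prems \<open>l = 0\<close>
        by (cases x) (auto simp: Cons_lenlex_iff)
    qed
  qed
qed

text \<open>
  Each variable of the algorithm is assigned exactly once per multi-index. The procedure is therefore
  written as a recursive definition of these values: \<open>zvar\<close> for \<open>z\<close>, \<open>zbar\<close> for \<open>z\<close> with a bar,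
  \<open>wvar\<close> for \<open>w\<close>, and \<open>Rec\<close> for the value returned by the call of the procedure at a multi-index,
  which is also \<open>z\<close> with a tilde. The equations for \<open>zvar\<close> are, in this order, the initialisation, the
  correction step in the loop, and the transfer of an iterate to the deeper levels
  \<open>l = k+2, \<dots>, n\<close> (here \<open>k = length t\<close> and \<open>l = k+2+m\<close>). The value of \<open>zbar\<close> at the empty index and all
  values at lists longer than \<open>n\<close> are irrelevant.
\<close>

context
  notes sum.cong [fundef_cong]
begin

function zvar :: "('d::finite) sliding_data \<Rightarrow> nat list \<Rightarrow> real^'d"
  and zbar :: "'d sliding_data \<Rightarrow> nat list \<Rightarrow> real^'d"
  and wvar :: "'d sliding_data \<Rightarrow> nat list \<Rightarrow> real^'d"
  and Rec :: "'d sliding_data \<Rightarrow> nat list \<Rightarrow> real^'d" where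
  "zvar D (replicate m 0) = input D"
| "zvar D (t @ [Suc j]) =
     arg_min_on (\<lambda>x.
        (oper D (Suc (length t)) (Rec D (t @ [j])) - oper D (Suc (length t)) (zvar D (t @ [j]))) \<bullet> x
        + 1 / 2 * reg D (t @ [j]) * (wnorm (weight D) (x - Rec D (t @ [j])))\<^sup>2) (feasible D)"
| "zvar D (t @ [Suc j] @ replicate (Suc m) 0) =
     zvar D (t @ [j, loops D (length t + 2)] @ replicate m 0)"
| "zbar D [] = input D"
| "zbar D (t @ [0]) = zvar D (t @ [0])"
| "zbar D (t @ [Suc j]) = mix D j *\<^sub>R Rec D (t @ [j]) + (1 - mix D j) *\<^sub>R zbar D (t @ [j])"
| "wvar D t =
     foldr (\<lambda>l x. mix D (t ! (l - 1)) *\<^sub>R x + (1 - mix D (t ! (l - 1))) *\<^sub>R zbar D (take l t))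
       [1..<Suc (length t)] (zvar D t)"
| "Rec D t =
     (if length t < levels D then zbar D (t @ [loops D (Suc (length t))])
      else arg_min_on (\<lambda>x. \<Sum>i = 1..levels D.
        (grad D i (wvar D (take i t)) + oper D i (zvar D (take i t))) \<bullet> x
        + 1 / 2 * reg D (take i t) * (wnorm (weight D) (x - zvar D (take i t)))\<^sup>2) (feasible D))"
proof goal_cases
  case (1 R x)
  show R
  proof (cases x)
    case (Inl y)
    show ?thesis
    proof (cases y)
      case (Inl v)
      obtain D s where v: "v = (D, s)" by (cases v)
      show ?thesis
      proof (cases s rule: index_cases)
        case (zero m)
        then show ?thesis using 1(1) \<open>x = Inl y\<close> Inl v by blast
      next
        case (succ t j m)
        then show ?thesis using 1(2,3) \<open>x = Inl y\<close> Inl v by (cases m) auto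
      qed
    next
      case (Inr v)
      obtain D s where v: "v = (D, s)" by (cases v)
      show ?thesis
      proof (cases s rule: rev_cases)
        case Nil
        then show ?thesis using 1(4) \<open>x = Inl y\<close> Inr v by blast
      next
        case (snoc t a)
        then show ?thesis using 1(5,6) \<open>x = Inl y\<close> Inr v by (cases a) blast+
      qed
    qed
  next
    case (Inr y)
    then show ?thesis using 1(7,8) by (cases y) auto
  qed
qed (simp_all add: index_simps)

end

termination
proof (relation "inv_image (lenlex less_than) (\<lambda>x. case x of
      Inl (Inl (D, t)) \<Rightarrow> t @ replicate (levels D - length t) 0 @ [length t, 0]
    | Inl (Inr (D, t)) \<Rightarrow> t @ replicate (levels D - length t) 0 @ [length t, 1]
    | Inr (Inl (D, t)) \<Rightarrow> t @ replicate (levels D - length t) 0 @ [length t, 2]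
    | Inr (Inr (D, t)) \<Rightarrow>
        if length t < levels D
        then t @ Suc (loops D (Suc (length t))) # replicate (levels D - Suc (length t)) 0 @ [0, 0]
        else t @ replicate (levels D - length t) 0 @ [length t, 3])", goal_cases)
  case 1
  show ?case by (intro wf_inv_image wf_lenlex wf_less_than)
qed (auto simp: lenlex_same_prefix Cons_lenlex_iff min_absorb2
    intro: lenlex_take lenlex_take[where m = 0, simplified])

definition z_out :: "('d::finite) sliding_data \<Rightarrow> real^'d" where
  "z_out D = Rec D []"

end

theory Submission
  imports Defs
begin

text \<open>
  The nested loops are handled by a potential function attached to each call of the procedure. Fix a
  comparison point \<open>z\<close> and a call at the multi-index \<open>t\<close> of length \<open>k\<close>. All dependence of \<open>w\<^sup>i\<close> on the
  enclosing loops goes through the map \<open>lift t = a\<^sub>1 \<circ> \<dots> \<circ> a\<^sub>k\<close>, which is affine with linear part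
  \<open>mass t = \<alpha>\<^sub>t\<^sub>1 \<cdots> \<alpha>\<^sub>t\<^sub>k\<close>. So a level \<open>i > k\<close>, whose loop lies inside the call, is measured by
  \<open>(p\<^sub>i(lift t x) - p\<^sub>i(lift t z)) / mass t + \<langle>Q\<^sub>i(z), x - z\<rangle>\<close>, while a level \<open>i \<le> k\<close>, whose data are
  frozen during the call, is measured by its linearised term and by the defect
  \<open>\<eta>/2 (\<parallel>x - z\<^sup>i\<parallel>\<^sup>2 + \<parallel>z - x\<parallel>\<^sup>2 - \<parallel>z - z\<^sup>i\<parallel>\<^sup>2)\<close> of the three-point inequality. Their sum is \<open>gap t x z\<close>.
  The claim for a call, \<open>call_bounded\<close>, is that the gap of the returned point is at most a sum over
  \<open>i > k\<close> of a multiple of the decrease of \<open>\<parallel>z - z\<^sup>i\<parallel>\<^sup>2\<close> during the call, plus the oracle errors.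

  For \<open>k = n\<close> the claim is the optimality of the minimiser (\<open>leaf_bound\<close>). For the passage from \<open>k + 1\<close>
  to \<open>k\<close>, two things are needed in one pass through the loop. First, level \<open>k + 1\<close> must be turned from a
  frozen level into an inner one (\<open>inner_le_outer_term\<close>): smoothness of \<open>p\<^sub>i\<close> costs
  \<open>L mass/2 \<parallel>x - z\<^sup>i\<parallel>\<^sup>2\<close>, the extragradient correction with the Lipschitz operator costs
  \<open>M\<^sup>2/(2\<eta>) \<parallel>x - z\<^sup>i\<parallel>\<^sup>2\<close>, and both are paid by the defect because \<open>\<eta> \<ge> L mass + M\<close>. Second, the average
  \<open>\<alpha>\<^sub>j x + (1 - \<alpha>\<^sub>j) y\<close> must be compared with its parts (\<open>gap_mix\<close>), which follows from
  convexity: of the frozen summands in \<open>x\<close>, and of \<open>p\<^sub>i\<close> at the moving comparison point \<open>lift t z\<close>. This gives the recursion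
  \<open>E\<^sub>j\<^sub>+\<^sub>1 \<le> (1 - \<alpha>\<^sub>j) E\<^sub>j + \<alpha>\<^sub>j\<^sup>2 (B\<^sub>j - B\<^sub>j\<^sub>+\<^sub>1) + e\<close> of accelerated methods. The choice of \<open>\<eta>\<close> makes the
  weights of \<open>B\<close> independent of \<open>j\<close>, and the transfer of the iterates \<open>z\<^sup>l\<close> to the next pass makes the
  distances telescope. With \<open>(1 - \<alpha>\<^sub>j\<^sub>+\<^sub>1) \<alpha>\<^sub>j\<^sup>2 = \<alpha>\<^sub>j\<^sub>+\<^sub>1\<^sup>2\<close> the recursion sums up
  (\<open>accelerated_recursion\<close>, \<open>loop_bound\<close>). The claim at the empty multi-index, together with
  \<open>\<alpha>\<^sub>T\<^sub>-\<^sub>1 \<le> 2/T\<close>, is the asserted estimate.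
\<close>

section \<open>The weighted norm and proximal steps\<close>

locale weighted_norm =
  fixes P :: "real^'d^'d"
  assumes P: "sym_pos_def P"
begin

abbreviation sqn :: "real^'d \<Rightarrow> real" where
  "sqn x \<equiv> (wnorm P x)\<^sup>2"

lemma wnorm_nonneg: "0 \<le> wnorm P x"
  using P by (cases "x = 0") (auto simp: wnorm_def sym_pos_def_def less_imp_le)

lemma sqn_eq: "sqn x = (P *v x) \<bullet> x"
proof -
  have "0 \<le> (P *v x) \<bullet> x"
    using P by (cases "x = 0") (auto simp: sym_pos_def_def less_imp_le)
  then show ?thesis by (simp add: wnorm_def)
qed

lemma form_sym: "(P *v x) \<bullet> y = (P *v y) \<bullet> x"
  using P by (metis sym_pos_def_def dot_lmul_matrix transpose_matrix_vector inner_commute)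

lemma sqn_add: "sqn (x + y) = sqn x + 2 * ((P *v x) \<bullet> y) + sqn y"
  using form_sym[of x y]
  by (simp add: sqn_eq matrix_vector_right_distrib inner_add_left inner_add_right)

lemma sqn_scale: "sqn (a *\<^sub>R x) = a\<^sup>2 * sqn x"
  unfolding sqn_eq by (simp add: matrix_vector_mult_scaleR power2_eq_square)

lemma sqn_minus_commute: "sqn (x - y) = sqn (y - x)"
  using sqn_scale[of "-1" "x - y"] by simp

lemma sqn_convex:
  assumes "0 \<le> a" "a \<le> 1"
  shows "sqn (a *\<^sub>R u + (1 - a) *\<^sub>R v) \<le> a * sqn u + (1 - a) * sqn v"
proof -
  have "a * sqn u + (1 - a) * sqn v - sqn (a *\<^sub>R u + (1 - a) *\<^sub>R v)
      = a * (1 - a) * sqn (u + (-1) *\<^sub>R v)"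
    unfolding sqn_add sqn_scale
    by (simp add: matrix_vector_mult_scaleR) (simp add: algebra_simps power2_eq_square)
  moreover have "0 \<le> a * (1 - a) * sqn (u + (-1) *\<^sub>R v)"
    using assms by simp
  ultimately show ?thesis by linarith
qed

text \<open>
  The minimum of the form over the unit sphere is positive. Coercivity is what makes the minimisers in
  the algorithm exist.
\<close>

lemma sqn_coercive: obtains m where "0 < m" "\<And>x. m * (norm x)\<^sup>2 \<le> sqn x"
proof -
  have cont: "continuous_on (sphere 0 1) (\<lambda>x. (P *v x) \<bullet> x)"
    by (intro continuous_intros matrix_vector_mult_linear_continuous_on)
  obtain w where w: "w \<in> sphere 0 1" "\<And>x. x \<in> sphere 0 1 \<Longrightarrow> sqn w \<le> sqn x"
    using continuous_attains_inf[OF compact_sphere _ cont] by (auto simp: sqn_eq)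
  show ?thesis
  proof (rule that)
    have "w \<noteq> 0" using w by auto
    then show "0 < sqn w" using P by (simp add: sqn_eq sym_pos_def_def)
    show "sqn w * (norm x)\<^sup>2 \<le> sqn x" for x
    proof (cases "x = 0")
      case False
      have "sqn x = (norm x)\<^sup>2 * sqn (sgn x)"
        using sqn_scale[of "norm x" "sgn x"] False by (simp add: sgn_div_norm)
      also have "\<dots> \<ge> (norm x)\<^sup>2 * sqn w"
        using w(2)[of "sgn x"] False by (intro mult_left_mono) (auto simp: norm_sgn)
      finally show ?thesis by (simp add: mult.commute)
    qed simp
  qed
qed

lemma dual_norm:
  shows "P *v (matrix_inv P *v s) = s"
    and "wnorm (matrix_inv P) s = wnorm P (matrix_inv P *v s)"
    and "0 \<le> wnorm (matrix_inv P) s"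
proof -
  have "P *v x = 0 \<Longrightarrow> x = 0" for x
    using P by (auto simp: sym_pos_def_def)
  then obtain B where B: "B ** P = mat 1"
    using matrix_left_invertible_ker[of P] by auto
  then have "invertible P"
    using invertible_left_inverse by blast
  then have inv: "P ** matrix_inv P = mat 1"
    unfolding invertible_def matrix_inv_def by (rule someI2_ex) auto
  show s: "P *v (matrix_inv P *v s) = s"
    using inv by (simp add: matrix_vector_mul_assoc)
  show dual: "wnorm (matrix_inv P) s = wnorm P (matrix_inv P *v s)"
    by (simp add: wnorm_def s inner_commute)
  show "0 \<le> wnorm (matrix_inv P) s"
    unfolding dual by (rule wnorm_nonneg)
qed

text \<open>
  Young's inequality for the pair of dual norms: expand \<open>\<parallel>P\<^sup>-\<^sup>1s - c x\<parallel>\<^sup>2 \<ge> 0\<close>.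
\<close>

lemma dual_young:
  assumes "0 < c"
  shows "s \<bullet> x \<le> (wnorm (matrix_inv P) s)\<^sup>2 / (2 * c) + c / 2 * sqn x"
proof -
  define y where "y = matrix_inv P *v s"
  have s: "P *v y = s" and dual: "wnorm (matrix_inv P) s = wnorm P y"
    by (simp_all add: y_def dual_norm)
  have "0 \<le> sqn (y + (- c) *\<^sub>R x)" by simp
  also have "\<dots> = sqn y - 2 * c * (s \<bullet> x) + c\<^sup>2 * sqn x"
    unfolding sqn_add sqn_scale by (simp add: s matrix_vector_mult_scaleR)
  finally show ?thesis
    using assms unfolding dual by (simp add: field_simps power2_eq_square)
qed

text \<open>
  Both minimisation steps of the algorithm minimise a function of the form \<open>f\<close>: the index set \<open>I\<close> is
  the set of levels in the innermost call and a singleton in the correction step.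
\<close>

context
  fixes Z :: "(real^'d) set" and I :: "'i set" and b :: "'i \<Rightarrow> real^'d" and c :: "'i \<Rightarrow> real"
    and y :: "'i \<Rightarrow> real^'d" and f and x0
  assumes Z: "Z \<noteq> {}" "closed Z" "convex Z"
    and I: "finite I" "I \<noteq> {}" and c: "\<And>i. i \<in> I \<Longrightarrow> 0 < c i"
  defines "f \<equiv> \<lambda>x. \<Sum>i\<in>I. b i \<bullet> x + 1 / 2 * c i * (wnorm P (x - y i))\<^sup>2"
begin

definition prox_grad where
  "prox_grad x = (\<Sum>i\<in>I. b i + c i *\<^sub>R (P *v (x - y i)))"

text \<open>
  Since \<open>f\<close> is quadratic, its second-order expansion is exact; existence of a minimiser and the
  three-point inequality are both read off from it.
\<close>

lemma prox_expand: "f z = f x + prox_grad x \<bullet> (z - x) + sum c I / 2 * sqn (z - x)"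
proof -
  have "b i \<bullet> z + 1 / 2 * c i * sqn (z - y i) =
      (b i \<bullet> x + 1 / 2 * c i * sqn (x - y i)) + (b i + c i *\<^sub>R (P *v (x - y i))) \<bullet> (z - x)
        + c i / 2 * sqn (z - x)" for i
  proof -
    have "sqn (z - y i) = sqn (x - y i) + 2 * ((P *v (x - y i)) \<bullet> (z - x)) + sqn (z - x)"
      using sqn_add[of "x - y i" "z - x"] by simp
    then show ?thesis
      by (simp add: inner_add_left inner_diff_right distrib_left right_diff_distrib)
  qed
  then have "f z = (\<Sum>i\<in>I. (b i \<bullet> x + 1 / 2 * c i * sqn (x - y i))
      + (b i + c i *\<^sub>R (P *v (x - y i))) \<bullet> (z - x) + c i / 2 * sqn (z - x))"
    unfolding f_def by (rule sum.cong[OF refl])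
  then show ?thesis
    unfolding f_def prox_grad_def inner_sum_left sum_distrib_right sum_divide_distrib
    by (simp only: sum.distrib)
qed

lemma prox_weight_pos: "0 < sum c I"
  using I c by (intro sum_pos) auto

text \<open>
  By the expansion at a feasible \<open>x0\<close>, the values outside a ball around \<open>x0\<close> exceed \<open>f x0\<close>, so the
  minimum over the compact part of \<open>Z\<close> inside that ball is a global one.
\<close>

lemma prox_attained: "is_arg_min f (\<lambda>x. x \<in> Z) (arg_min_on f Z)"
proof -
  obtain x0 where x0: "x0 \<in> Z" using Z by auto
  obtain m where m: "0 < m" "\<And>x. m * (norm x)\<^sup>2 \<le> sqn x" using sqn_coercive by blast
  define C where "C = sum c I / 2 * m"
  have C: "0 < C" using prox_weight_pos m by (simp add: C_def)
  define S where "S = Z \<inter> cball x0 (norm (prox_grad x0) / C)"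
  have cont: "continuous_on S f"
    unfolding f_def sqn_eq
    by (intro continuous_intros matrix_vector_mult_linear_continuous_on
        linear_continuous_on_compose[of _ _ "\<lambda>x. P *v x"])
       auto
  have "compact S" using Z by (simp add: S_def closed_Int_compact)
  moreover have "x0 \<in> S" using x0 C by (simp add: S_def)
  ultimately obtain w where w: "w \<in> S" "\<And>x. x \<in> S \<Longrightarrow> f w \<le> f x"
    using continuous_attains_inf[of S f] cont by blast
  have "f w \<le> f x" if "x \<in> Z" for x
  proof (cases "x \<in> S")
    case False
    define r where "r = norm (x - x0)"
    have "norm (prox_grad x0) / C < r"
      using False that by (auto simp: S_def dist_norm r_def norm_minus_commute)
    then have r: "norm (prox_grad x0) < C * r" "0 \<le> r"
      using C by (auto simp: field_simps r_def)
    have "- (norm (prox_grad x0) * r) \<le> prox_grad x0 \<bullet> (x - x0)"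
      using Cauchy_Schwarz_ineq2[of "prox_grad x0" "x - x0"] by (simp add: r_def abs_le_iff)
    moreover have "C * r\<^sup>2 \<le> sum c I / 2 * sqn (x - x0)"
      using mult_left_mono[OF m(2)[of "x - x0"], of "sum c I / 2"] prox_weight_pos
      by (simp add: C_def r_def mult.assoc)
    moreover have "norm (prox_grad x0) * r \<le> C * r * r"
      using r by (intro mult_right_mono) auto
    ultimately have "f x0 \<le> f x"
      using prox_expand[of x x0] by (simp add: power2_eq_square)
    then show ?thesis using w(2)[OF \<open>x0 \<in> S\<close>] by simp
  qed (use w in auto)
  then have "is_arg_min f (\<lambda>x. x \<in> Z) w"
    using w(1) by (auto simp: is_arg_min_linorder S_def)
  then show ?thesis
    unfolding arg_min_on_def arg_min_def by (rule someI)
qed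

lemma prox_in: "arg_min_on f Z \<in> Z"
  using prox_attained by (simp add: is_arg_min_linorder)

text \<open>
  The minimiser satisfies \<open>f x + C/2 \<parallel>z - x\<parallel>\<^sup>2 \<le> f z\<close> with \<open>C = \<Sum>c\<^sub>i\<close>. Written out term by term, the
  strong convexity is distributed over the summands, which lets each level be treated by itself later.
\<close>

lemma prox_three_point:
  assumes z: "z \<in> Z"
  defines "x \<equiv> arg_min_on f Z"
  shows "(\<Sum>i\<in>I. b i \<bullet> (x - z) + c i / 2 * (sqn (x - y i) + sqn (z - x) - sqn (z - y i))) \<le> 0"
proof -
  have x: "x \<in> Z" "\<And>w. w \<in> Z \<Longrightarrow> f x \<le> f w"
    using prox_attained by (auto simp: is_arg_min_linorder x_def)
  define g C where "g = prox_grad x \<bullet> (z - x)" and "C = sum c I / 2 * sqn (z - x)"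
  have C: "0 \<le> C" using prox_weight_pos by (simp add: C_def)
  \<comment> \<open>Minimality along the segment from \<open>x\<close> to \<open>z\<close>; letting \<open>s\<close> tend to \<open>0\<close> gives the sign of \<open>g\<close>.\<close>
  have small: "0 \<le> g + s * C" if "0 < s" "s \<le> 1" for s
  proof -
    have "x + s *\<^sub>R (z - x) \<in> Z"
      using convexD_alt[OF Z(3) x(1) z, of s] that by (simp add: algebra_simps)
    from x(2)[OF this] have "0 \<le> s * g + s\<^sup>2 * C"
      using prox_expand[of "x + s *\<^sub>R (z - x)" x]
      by (simp add: sqn_scale g_def C_def mult.left_commute)
    then have "0 \<le> s * (g + s * C)" by (simp add: algebra_simps power2_eq_square)
    then show ?thesis using that by (simp add: zero_le_mult_iff)
  qed
  have "0 \<le> g"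
  proof (rule tendsto_lowerbound)
    show "((\<lambda>s. g + s * C) \<longlongrightarrow> g) (at_right 0)"
      by (auto intro!: tendsto_eq_intros)
    show "\<forall>\<^sub>F s in at_right 0. 0 \<le> g + s * C"
      using small by (intro eventually_at_rightI[of 0 1]) auto
  qed simp
  then have "f x + C \<le> f z"
    using prox_expand[of z x] by (simp add: g_def C_def)
  moreover have "(\<Sum>i\<in>I. b i \<bullet> (x - z) + c i / 2 * (sqn (x - y i) + sqn (z - x) - sqn (z - y i)))
      = f x + C - f z"
    by (simp add: f_def C_def sum.distrib sum_subtractf sum_distrib_right sum_divide_distrib
        inner_diff_right algebra_simps diff_divide_distrib add_divide_distrib)
  ultimately show ?thesis by simp
qed

end

end

section \<open>The averaging weights\<close>

locale step_weights =
  fixes \<alpha> :: "nat \<Rightarrow> real"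
  assumes alpha_0: "\<alpha> 0 = 1"
    and alpha_Suc: "\<And>t. \<alpha> (Suc t) = 2 / (1 + sqrt (1 + 4 / (\<alpha> t)\<^sup>2))"
begin

lemma alpha_pos: "0 < \<alpha> t"
proof (induction t)
  case (Suc t)
  have "0 \<le> sqrt (1 + 4 / (\<alpha> t)\<^sup>2)" by simp
  then show ?case unfolding alpha_Suc by (intro divide_pos_pos) linarith+
qed (simp add: alpha_0)

text \<open>
  The recursion for \<open>\<alpha>\<close> is the positive root of this quadratic equation, which is the identity that
  makes accelerated estimates telescope.
\<close>

lemma alpha_balance: "(1 - \<alpha> (Suc t)) * (\<alpha> t)\<^sup>2 = (\<alpha> (Suc t))\<^sup>2"
proof -
  define s where "s = sqrt (1 + 4 / (\<alpha> t)\<^sup>2)"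
  have s: "0 \<le> s" "s\<^sup>2 = 1 + 4 / (\<alpha> t)\<^sup>2" by (auto simp: s_def)
  have "(s\<^sup>2 - 1) * (\<alpha> t)\<^sup>2 = 4" using alpha_pos[of t] s(2) by simp
  then have "(s - 1) * (s + 1) * (\<alpha> t)\<^sup>2 = 4" by (simp add: algebra_simps power2_eq_square)
  then show ?thesis
    using s(1) unfolding alpha_Suc s_def[symmetric]
    by (simp add: divide_simps power2_eq_square) (simp add: algebra_simps)
qed

lemma alpha_inverse_growth: "1 / \<alpha> t + 1 / 2 \<le> 1 / \<alpha> (Suc t)"
proof -
  have "2 / \<alpha> t \<le> sqrt (1 + 4 / (\<alpha> t)\<^sup>2)"
    by (rule real_le_rsqrt) (simp add: power_divide)
  then show ?thesis by (simp add: alpha_Suc)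
qed

lemma alpha_antimono: "s \<le> t \<Longrightarrow> \<alpha> t \<le> \<alpha> s"
proof (rule lift_Suc_antimono_le[of \<alpha>])
  fix t
  have "1 / \<alpha> t \<le> 1 / \<alpha> (Suc t)" using alpha_inverse_growth[of t] by simp
  then show "\<alpha> (Suc t) \<le> \<alpha> t" using alpha_pos by (simp add: field_simps)
qed

lemma alpha_le_1: "\<alpha> t \<le> 1"
  using alpha_antimono[of 0 t] alpha_0 by simp

lemma alpha_le: "0 < T \<Longrightarrow> \<alpha> (T - 1) \<le> 2 / real T"
proof -
  have "(real t + 2) / 2 \<le> 1 / \<alpha> t" for t
  proof (induction t)
    case (Suc t)
    then show ?case using alpha_inverse_growth[of t] by (simp add: field_simps)
  qed (simp add: alpha_0)
  from this[of "T - 1"] show "0 < T \<Longrightarrow> \<alpha> (T - 1) \<le> 2 / real T"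
    using alpha_pos[of "T - 1"] by (simp add: field_simps of_nat_diff)
qed

text \<open>
  Dividing by \<open>\<alpha>\<^sub>j\<^sup>2\<close> turns the factor \<open>1 - \<alpha>\<^sub>j\<close> into a shift of the index, so that the differences of
  \<open>B\<close> telescope. The initial value \<open>E 0\<close> is multiplied by \<open>1 - \<alpha>\<^sub>0 = 0\<close>. The errors are not amplified
  since \<open>1 - \<alpha>\<^sub>j \<le> 1\<close>.
\<close>

lemma accelerated_recursion:
  assumes step: "\<And>j. j < T \<Longrightarrow>
      E (Suc j) \<le> (1 - \<alpha> j) * E j + (\<alpha> j)\<^sup>2 * (B j - B (Suc j)) + e"
    and "0 \<le> e" "0 < T"
  shows "E T \<le> (\<alpha> (T - 1))\<^sup>2 * (B 0 - B T) + real T * e"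
proof -
  have "E (Suc j) \<le> (\<alpha> j)\<^sup>2 * (B 0 - B (Suc j)) + real (Suc j) * e" if "j < T" for j
    using that
  proof (induction j)
    case 0
    then show ?case using step[of 0] by (simp add: alpha_0)
  next
    case (Suc j)
    have "(1 - \<alpha> (Suc j)) * E (Suc j)
        \<le> (1 - \<alpha> (Suc j)) * ((\<alpha> j)\<^sup>2 * (B 0 - B (Suc j)) + real (Suc j) * e)"
      using Suc alpha_le_1[of "Suc j"] by (intro mult_left_mono) auto
    also have "\<dots> = (\<alpha> (Suc j))\<^sup>2 * (B 0 - B (Suc j)) + (1 - \<alpha> (Suc j)) * (real (Suc j) * e)"
      by (simp add: distrib_left mult.assoc flip: alpha_balance)
    also have "\<dots> \<le> (\<alpha> (Suc j))\<^sup>2 * (B 0 - B (Suc j)) + 1 * (real (Suc j) * e)"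
      using alpha_pos[of "Suc j"] \<open>0 \<le> e\<close> by (intro add_left_mono mult_right_mono) auto
    finally show ?case using step[OF Suc.prems] by (simp add: algebra_simps)
  qed
  from this[of "T - 1"] \<open>0 < T\<close> show ?thesis by simp
qed

end

section \<open>Multi-indices, averaging maps and step sizes\<close>

locale sliding = weighted_norm P + step_weights \<alpha>
  for P :: "real^'d^'d" and \<alpha> :: "nat \<Rightarrow> real" +
  fixes Z :: "(real^'d) set" and n :: nat
    and p p' :: "nat \<Rightarrow> real^'d \<Rightarrow> real" and gp Q :: "nat \<Rightarrow> real^'d \<Rightarrow> real^'d"
    and L M \<delta> :: "nat \<Rightarrow> real" and T :: "nat \<Rightarrow> nat"
    and \<eta> :: "nat list \<Rightarrow> real" and z_in :: "real^'d"
  assumes Z: "Z \<noteq> {}" "closed Z" "convex Z"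
    and p_convex: "\<And>i. i \<in> {1..n} \<Longrightarrow> convex_on Z (p i)"
    and Q_mono: "\<And>i. i \<in> {1..n} \<Longrightarrow> monotone_operator Z (Q i)"
    and LM: "\<And>i. i \<in> {1..n} \<Longrightarrow> 0 \<le> M i \<and> 0 \<le> L i \<and> 0 < M i + L i"
    and Q_lip: "\<And>i. i \<in> {1..n} \<Longrightarrow> lipschitz_operator P Z (M i) (Q i)"
    and p_oracle: "\<And>i. i \<in> {1..n} \<Longrightarrow> first_order_oracle P Z (p i) (p' i) (gp i) (\<delta> i) (L i)"
    and T_pos: "\<And>i. i \<in> {1..n} \<Longrightarrow> 0 < T i"
    and eta: "\<And>k t. k \<in> {1..n} \<Longrightarrow> length t = k \<Longrightarrow> (\<And>l. l \<in> {1..k} \<Longrightarrow> t ! (l - 1) \<le> T l - 1) \<Longrightarrow>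
      \<eta> t = L k * (\<Prod>l=1..k. \<alpha> (t ! (l - 1))) + M k * (\<Prod>l=1..k. \<alpha> (t ! (l - 1)) / \<alpha> (T l - 1))"
    and z_in: "z_in \<in> Z"
begin

definition data :: "'d sliding_data" where
  "data = \<lparr>weight = P, feasible = Z, levels = n, grad = gp, oper = Q,
      loops = T, mix = \<alpha>, reg = \<eta>, input = z_in\<rparr>"

lemma data_simps [simp]:
  "weight data = P" "feasible data = Z" "levels data = n" "grad data = gp" "oper data = Q"
  "loops data = T" "mix data = \<alpha>" "reg data = \<eta>" "input data = z_in"
  by (simp_all add: data_def)

abbreviation "zv \<equiv> zvar data"
abbreviation "zb \<equiv> zbar data"
abbreviation "wv \<equiv> wvar data"
abbreviation "rec \<equiv> Rec data"

declare zvar.simps [simp del] zbar.simps [simp del] wvar.simps [simp del] Rec.simps [simp del]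

text \<open>
  The multi-indices at which the procedure is called.
\<close>

definition valid :: "nat list \<Rightarrow> bool" where
  "valid t \<longleftrightarrow> length t \<le> n \<and> (\<forall>l<length t. t ! l < T (Suc l))"

definition mass :: "nat list \<Rightarrow> real" where
  "mass t = (\<Prod>l=1..length t. \<alpha> (t ! (l - 1)))"

text \<open>
  Together with \<open>mass\<close>, this is the decomposition \<open>\<eta> = L mass + M rel_mass\<close> of the step sizes.
\<close>

definition rel_mass :: "nat list \<Rightarrow> real" where
  "rel_mass t = (\<Prod>l=1..length t. \<alpha> (t ! (l - 1)) / \<alpha> (T l - 1))"

text \<open>
  The composition \<open>a\<^sub>1 \<circ> \<dots> \<circ> a\<^sub>k\<close>, kept as a map because it is applied to the point returned by a call
  and to the comparison point as well as to \<open>z\<^sup>k\<close>.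
\<close>

definition lift :: "nat list \<Rightarrow> real^'d \<Rightarrow> real^'d" where
  "lift t = foldr (\<lambda>l x. \<alpha> (t ! (l - 1)) *\<^sub>R x + (1 - \<alpha> (t ! (l - 1))) *\<^sub>R zb (take l t))
       [1..<Suc (length t)]"

lemma valid_Nil: "valid []"
  by (simp add: valid_def)

lemma valid_snoc: "valid (t @ [j]) \<longleftrightarrow> length t < n \<and> valid t \<and> j < T (Suc (length t))"
  by (auto simp: valid_def nth_append less_Suc_eq)

lemma valid_take: "valid t \<Longrightarrow> valid (take i t)"
  by (auto simp: valid_def)

text \<open>
  The entry \<open>t\<^sub>l\<close> is \<open>t ! (l - 1)\<close>, so appending an entry leaves the factors for \<open>l \<le> length t\<close>
  unchanged.
\<close>

lemma prod_index_snoc: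
  "(\<Prod>l=1..length (t @ [j]). f l ((t @ [j]) ! (l - 1))) =
    (\<Prod>l=1..length t. f l (t ! (l - 1))) * (f (Suc (length t)) j :: real)"
  by (auto simp: nth_append intro!: prod.cong)

lemma mass_Nil [simp]: "mass [] = 1"
  by (simp add: mass_def)

lemma rel_mass_Nil [simp]: "rel_mass [] = 1"
  by (simp add: rel_mass_def)

lemma mass_snoc: "mass (t @ [j]) = mass t * \<alpha> j"
  unfolding mass_def by (rule prod_index_snoc[where f = "\<lambda>_ j. \<alpha> j"])

lemma rel_mass_snoc:
  "rel_mass (t @ [j]) = rel_mass t * (\<alpha> j / \<alpha> (T (Suc (length t)) - 1))"
  unfolding rel_mass_def by (rule prod_index_snoc[where f = "\<lambda>l j. \<alpha> j / \<alpha> (T l - 1)"])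

lemma mass_pos: "0 < mass t"
  by (simp add: mass_def prod_pos alpha_pos)

lemma rel_mass_ge_1:
  assumes "valid t"
  shows "1 \<le> rel_mass t"
  unfolding rel_mass_def
proof (rule prod_ge_1)
  fix l assume l: "l \<in> {1..length t}"
  then have "t ! (l - 1) < T (Suc (l - 1))"
    using assms unfolding valid_def by (metis One_nat_def Suc_le_eq Suc_pred atLeastAtMost_iff)
  then have "\<alpha> (T l - 1) \<le> \<alpha> (t ! (l - 1))"
    using l by (intro alpha_antimono) auto
  then show "1 \<le> \<alpha> (t ! (l - 1)) / \<alpha> (T l - 1)"
    using alpha_pos by simp
qed

lemma eta_eq:
  assumes "valid t" "t \<noteq> []"
  shows "\<eta> t = L (length t) * mass t + M (length t) * rel_mass t"
  unfolding mass_def rel_mass_def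
proof (rule eta)
  show "length t \<in> {1..n}" using assms by (cases t) (auto simp: valid_def)
  fix l assume "l \<in> {1..length t}"
  then have "t ! (l - 1) < T l"
    using assms(1)[unfolded valid_def, THEN conjunct2, rule_format, of "l - 1"] by auto
  then show "t ! (l - 1) \<le> T l - 1" by simp
qed simp

text \<open>
  The step size dominates the sum of the smoothness constant seen through \<open>lift t\<close> and the Lipschitz
  constant, because every factor of \<open>rel_mass\<close> is at least \<open>1\<close>.
\<close>

lemma eta_ge:
  assumes "valid t" "t \<noteq> []"
  shows "L (length t) * mass t + M (length t) \<le> \<eta> t"
  using eta_eq[OF assms] rel_mass_ge_1[OF assms(1)] LM[of "length t"] assms
    mult_left_mono[of 1 "rel_mass t" "M (length t)"]
  by (cases t) (auto simp: valid_def)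

lemma eta_pos:
  assumes "valid t" "t \<noteq> []"
  shows "0 < \<eta> t"
proof -
  have "length t \<in> {1..n}" using assms by (cases t) (auto simp: valid_def)
  note lm = LM[OF this]
  have "0 < L (length t) * mass t + M (length t)"
    using lm mass_pos[of t] by (cases "M (length t) = 0") (auto intro: add_nonneg_pos)
  then show ?thesis using eta_ge[OF assms] by linarith
qed

text \<open>
  An oracle evaluated at its own base point squeezes \<open>0\<close> below \<open>\<delta>\<close>.
\<close>

lemma delta_nonneg:
  assumes "i \<in> {1..n}"
  shows "0 \<le> \<delta> i"
proof -
  obtain u where "u \<in> Z" using Z by auto
  then have "0 \<le> p i u - p' i u - gp i u \<bullet> (u - u) \<and>
      p i u - p' i u - gp i u \<bullet> (u - u) \<le> L i / 2 * sqn (u - u) + \<delta> i"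
    using p_oracle[OF assms] unfolding first_order_oracle_def by blast
  then show ?thesis by (simp add: sqn_eq)
qed

lemma lift_Nil [simp]: "lift [] x = x"
  by (simp add: lift_def)

lemma lift_snoc: "lift (t @ [j]) x = lift t (\<alpha> j *\<^sub>R x + (1 - \<alpha> j) *\<^sub>R zb (t @ [j]))"
proof -
  have "foldr (\<lambda>l x. \<alpha> ((t @ [j]) ! (l - 1)) *\<^sub>R x
          + (1 - \<alpha> ((t @ [j]) ! (l - 1))) *\<^sub>R zb (take l (t @ [j]))) [1..<Suc (length t)] y
      = lift t y" for y
    unfolding lift_def by (rule foldr_cong) (auto simp: nth_append)
  then show ?thesis by (simp add: lift_def[of "t @ [j]"])
qed

lemma wv_eq: "wv t = lift t (zv t)"
  by (simp add: wvar.simps lift_def)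

lemma lift_diff: "lift t x - lift t y = mass t *\<^sub>R (x - y)"
proof (induction t arbitrary: x y rule: rev_induct)
  case (snoc j t)
  show ?case by (simp add: lift_snoc snoc mass_snoc algebra_simps)
qed simp

lemma lift_affine:
  "lift t (a *\<^sub>R x + (1 - a) *\<^sub>R y) = a *\<^sub>R lift t x + (1 - a) *\<^sub>R lift t y"
proof -
  have "lift t (a *\<^sub>R x + (1 - a) *\<^sub>R y) = lift t y + a *\<^sub>R (mass t *\<^sub>R (x - y))"
    using lift_diff[of t "a *\<^sub>R x + (1 - a) *\<^sub>R y" y] by (simp add: algebra_simps)
  also have "\<dots> = a *\<^sub>R lift t x + (1 - a) *\<^sub>R lift t y"
    unfolding lift_diff[symmetric] by (simp add: algebra_simps)
  finally show ?thesis .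
qed

lemma mix_in: "x \<in> Z \<Longrightarrow> y \<in> Z \<Longrightarrow> \<alpha> j *\<^sub>R x + (1 - \<alpha> j) *\<^sub>R y \<in> Z"
  using convexD[OF Z(3), of x y "\<alpha> j" "1 - \<alpha> j"] alpha_pos[of j] alpha_le_1[of j] by simp

section \<open>The gap of a call\<close>

text \<open>
  Feasibility of every variable that a call at \<open>t\<close> finds when it starts: the data of the enclosing
  levels and the starting points of the levels inside. It is established along with the bounds, since
  the minimisers are feasible only where the step sizes are known to be positive.
\<close>

definition entry_feasible :: "nat list \<Rightarrow> bool" where
  "entry_feasible t \<longleftrightarrow>
     (\<forall>l\<in>{1..length t}. zv (take l t) \<in> Z \<and> zb (take l t) \<in> Z) \<and>
     (\<forall>m. length t + m < n \<longrightarrow> zv (t @ replicate (Suc m) 0) \<in> Z)"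

lemma lift_in:
  assumes "\<And>l. l \<in> {1..length t} \<Longrightarrow> zb (take l t) \<in> Z" "x \<in> Z"
  shows "lift t x \<in> Z"
  using assms
proof (induction t arbitrary: x rule: rev_induct)
  case (snoc j t)
  have "zb (take l t) \<in> Z" if "l \<in> {1..length t}" for l
    using snoc.prems(1)[of l] that by simp
  moreover have "zb (t @ [j]) \<in> Z"
    using snoc.prems(1)[of "length (t @ [j])"] by simp
  ultimately show ?case
    using snoc.IH snoc.prems(2) mix_in unfolding lift_snoc by blast
qed simp

text \<open>
  A level whose loop encloses the call contributes its linearised summand and the three-point defect; a
  level inside the call contributes its gap seen through \<open>lift t\<close> and normalised by the linear part of
  that map. At the empty multi-index only inner terms remain, and \<open>gap\<close> is the quantity to be bounded.
\<close>

definition outer_term :: "nat list \<Rightarrow> real^'d \<Rightarrow> real^'d \<Rightarrow> real" where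
  "outer_term s x z = (gp (length s) (wv s) + Q (length s) (zv s)) \<bullet> (x - z)
     + \<eta> s / 2 * (sqn (x - zv s) + sqn (z - x) - sqn (z - zv s))"

definition inner_term :: "nat \<Rightarrow> nat list \<Rightarrow> real^'d \<Rightarrow> real^'d \<Rightarrow> real" where
  "inner_term i t x z = (p i (lift t x) - p i (lift t z)) / mass t + Q i z \<bullet> (x - z)"

definition gap :: "nat list \<Rightarrow> real^'d \<Rightarrow> real^'d \<Rightarrow> real" where
  "gap t x z = (\<Sum>i=1..length t. outer_term (take i t) x z)
     + (\<Sum>i=Suc (length t)..n. inner_term i t x z)"

text \<open>
  The weights of the distances and the accumulated error of level \<open>i\<close> after the loops
  \<open>i, i - 1, \<dots>, length t + 1\<close> have been summed up. For \<open>i = length t\<close> they are \<open>\<eta> t / 2\<close> and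
  \<open>\<delta>\<^sub>i / mass t\<close>. Summing a loop over \<open>j\<close> multiplies the distance weights by \<open>\<alpha>\<^sub>T\<^sub>-\<^sub>1\<^sup>2 / \<alpha>\<^sub>j\<close>; in
  the \<open>M\<close>-part one factor \<open>\<alpha>\<^sub>T\<^sub>-\<^sub>1\<close> cancels against the denominator of \<open>rel_mass\<close>.
\<close>

definition coef :: "nat \<Rightarrow> nat list \<Rightarrow> real" where
  "coef i t = 1 / 2 * (L i * mass t * (\<Prod>l=Suc (length t)..i. (\<alpha> (T l - 1))\<^sup>2)
     + M i * rel_mass t * (\<Prod>l=Suc (length t)..i. \<alpha> (T l - 1)))"

definition err :: "nat \<Rightarrow> nat list \<Rightarrow> real" where
  "err i t = \<delta> i / mass t * (\<Prod>l=Suc (length t)..i. real (T l))"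

text \<open>
  The squared distance from \<open>z\<close> to the level-\<open>i\<close> iterate after \<open>j\<close> passes of the loop run by
  the call at \<open>t\<close>; the index is padded by zeros to length \<open>i\<close>.
\<close>

definition dist_at :: "real^'d \<Rightarrow> nat \<Rightarrow> nat list \<Rightarrow> nat \<Rightarrow> real" where
  "dist_at z i t j = sqn (z - zv (t @ [j] @ replicate (i - Suc (length t)) 0))"

lemma outer_term_mix:
  assumes s: "valid s" "s \<noteq> []"
  shows "outer_term s (\<alpha> j *\<^sub>R u + (1 - \<alpha> j) *\<^sub>R v) z
     \<le> \<alpha> j * outer_term s u z + (1 - \<alpha> j) * outer_term s v z"
proof -
  let ?x = "\<alpha> j *\<^sub>R u + (1 - \<alpha> j) *\<^sub>R v"
  have shift: "?x - y = \<alpha> j *\<^sub>R (u - y) + (1 - \<alpha> j) *\<^sub>R (v - y)" for y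
    by (simp add: algebra_simps)
  have sq: "sqn (?x - y) \<le> \<alpha> j * sqn (u - y) + (1 - \<alpha> j) * sqn (v - y)" for y
    unfolding shift using alpha_pos[of j] alpha_le_1[of j] by (intro sqn_convex) auto
  let ?g = "gp (length s) (wv s) + Q (length s) (zv s)"
  have "outer_term s ?x z
      \<le> ?g \<bullet> (?x - z) + \<eta> s / 2 * ((\<alpha> j * sqn (u - zv s) + (1 - \<alpha> j) * sqn (v - zv s))
        + (\<alpha> j * sqn (u - z) + (1 - \<alpha> j) * sqn (v - z)) - sqn (z - zv s))"
    unfolding outer_term_def sqn_minus_commute[of z ?x]
    using eta_pos[OF s] sq[of "zv s"] sq[of z] by (intro add_left_mono mult_left_mono) auto
  also have "\<dots> = \<alpha> j * outer_term s u z + (1 - \<alpha> j) * outer_term s v z"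
    unfolding outer_term_def shift[of z] inner_add_right inner_scaleR_right
      sqn_minus_commute[of z u] sqn_minus_commute[of z v]
    by (simp add: field_simps)
  finally show ?thesis .
qed

text \<open>
  The left-hand side evaluates \<open>p\<^sub>i\<close> at \<open>lift (t @ [j]) u\<close>, exactly as the first term on the right does.
  Convexity is therefore used only for the comparison points: \<open>lift (t @ [j]) z\<close> is a convex combination
  of \<open>lift t z\<close> and \<open>lift t\<close> of the running average.
\<close>

lemma inner_term_mix:
  assumes i: "i \<in> {1..n}" and t: "entry_feasible t" "zb (t @ [j]) \<in> Z" and z: "z \<in> Z"
  shows "inner_term i t (\<alpha> j *\<^sub>R u + (1 - \<alpha> j) *\<^sub>R zb (t @ [j])) z
     \<le> \<alpha> j * inner_term i (t @ [j]) u z + (1 - \<alpha> j) * inner_term i t (zb (t @ [j])) z"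
proof -
  let ?v = "zb (t @ [j])"
  have in_Z: "lift t x \<in> Z" if "x \<in> Z" for x
    using lift_in that t(1) by (simp add: entry_feasible_def)
  have "p i (lift (t @ [j]) z) \<le> \<alpha> j * p i (lift t z) + (1 - \<alpha> j) * p i (lift t ?v)"
    unfolding lift_snoc lift_affine
    using convex_onD[OF p_convex[OF i], of "1 - \<alpha> j" "lift t z" "lift t ?v"]
      in_Z z t alpha_pos[of j] alpha_le_1[of j] by simp
  then have conv: "p i (lift (t @ [j]) u) - p i (lift t z)
      \<le> (p i (lift (t @ [j]) u) - p i (lift (t @ [j]) z))
        + (1 - \<alpha> j) * (p i (lift t ?v) - p i (lift t z))"
    by (simp add: algebra_simps)
  have "(p i (lift (t @ [j]) u) - p i (lift t z)) / mass t
      \<le> \<alpha> j * ((p i (lift (t @ [j]) u) - p i (lift (t @ [j]) z)) / mass (t @ [j]))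
        + (1 - \<alpha> j) * ((p i (lift t ?v) - p i (lift t z)) / mass t)"
    using divide_right_mono[OF conv, of "mass t"] mass_pos[of t] alpha_pos[of j]
    by (simp add: mass_snoc add_divide_distrib)
  moreover have "Q i z \<bullet> (\<alpha> j *\<^sub>R u + (1 - \<alpha> j) *\<^sub>R ?v - z)
      = \<alpha> j * (Q i z \<bullet> (u - z)) + (1 - \<alpha> j) * (Q i z \<bullet> (?v - z))"
    by (simp add: inner_diff_right inner_add_right algebra_simps)
  ultimately show ?thesis
    unfolding inner_term_def lift_snoc[symmetric] by (simp add: distrib_left)
qed

section \<open>One pass through a loop\<close>

lemma correction_step:
  assumes t: "valid (t @ [j])" and x: "rec (t @ [j]) \<in> Z"
  shows "zv (t @ [Suc j]) \<in> Z"
    and "z \<in> Z \<Longrightarrow>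
      (Q (Suc (length t)) (rec (t @ [j])) - Q (Suc (length t)) (zv (t @ [j]))) \<bullet> (zv (t @ [Suc j]) - z)
      + \<eta> (t @ [j]) / 2 * (sqn (zv (t @ [Suc j]) - rec (t @ [j])) + sqn (z - zv (t @ [Suc j]))
          - sqn (z - rec (t @ [j]))) \<le> 0"
proof -
  let ?i = "Suc (length t)"
  let ?b = "Q ?i (rec (t @ [j])) - Q ?i (zv (t @ [j]))"
  have pos: "0 < \<eta> (t @ [j])" using eta_pos[OF t] by simp
  show "zv (t @ [Suc j]) \<in> Z"
    using prox_in[OF Z, where I = "{()}" and c = "\<lambda>_. \<eta> (t @ [j])" and b = "\<lambda>_. ?b"
        and y = "\<lambda>_. rec (t @ [j])"] pos
    by (simp add: zvar.simps(2))
  show "?b \<bullet> (zv (t @ [Suc j]) - z)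
      + \<eta> (t @ [j]) / 2 * (sqn (zv (t @ [Suc j]) - rec (t @ [j])) + sqn (z - zv (t @ [Suc j]))
          - sqn (z - rec (t @ [j]))) \<le> 0" if "z \<in> Z"
    using prox_three_point[OF Z, where I = "{()}" and c = "\<lambda>_. \<eta> (t @ [j])" and b = "\<lambda>_. ?b"
        and y = "\<lambda>_. rec (t @ [j])", OF _ _ _ that] pos
    by (simp add: zvar.simps(2))
qed

text \<open>
  The level whose loop is being run changes from a frozen level into an inner one, at the price of the
  decrease of the distance to its iterate. The two quadratic costs \<open>L mass/2 \<parallel>x - y\<parallel>\<^sup>2\<close> (smoothness) and
  \<open>(\<eta> - L mass)/2 \<parallel>x - y\<parallel>\<^sup>2\<close> (Lipschitz continuity, after Young's inequality) add up to exactly the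
  defect \<open>\<eta>/2 \<parallel>x - y\<parallel>\<^sup>2\<close> that is available.
\<close>

lemma inner_le_outer_term:
  assumes t: "valid s" "s = t @ [j]" and i: "i = length s"
    and x: "x = rec s" "x \<in> Z" and ok: "entry_feasible s" and z: "z \<in> Z"
  shows "inner_term i s x z
    \<le> outer_term s x z + \<eta> s / 2 * (sqn (z - zv s) - sqn (z - zv (t @ [Suc j]))) + \<delta> i / mass s"
proof -
  define y where "y = zv s"
  define w where "w = zv (t @ [Suc j])"
  have i': "i \<in> {1..n}" "i = Suc (length t)" using t i by (auto simp: valid_def)
  have y: "y \<in> Z" "wv s \<in> Z" "lift s x \<in> Z" "lift s z \<in> Z"
  proof -
    have "s = take i s" "i \<in> {1..length s}" using t i by auto
    then show "y \<in> Z" using ok by (metis entry_feasible_def y_def)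
    then show "wv s \<in> Z" "lift s x \<in> Z" "lift s z \<in> Z"
      using lift_in[of s] ok x z by (auto simp: entry_feasible_def wv_eq y_def)
  qed
  have w: "w \<in> Z"
    and corr: "(Q i x - Q i y) \<bullet> (w - z) + \<eta> s / 2 * (sqn (w - x) + sqn (z - w) - sqn (z - x)) \<le> 0"
    using correction_step(1)[of t j] correction_step(2)[of t j z] t x i' z
    by (simp_all add: w_def y_def)
  have lm: "0 \<le> M i" "0 \<le> L i" using LM[OF i'(1)] by auto
  have eta: "0 < \<eta> s" "L i * mass s + M i \<le> \<eta> s"
    using eta_pos[OF t(1)] eta_ge[OF t(1)] t(2) i by auto
  \<comment> \<open>The oracle at \<open>w\<close> bounds \<open>p\<^sub>i\<close> from above at \<open>lift s x\<close> and from below at \<open>lift s z\<close>.\<close>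
  have shift: "lift s x - wv s = mass s *\<^sub>R (x - y)" "lift s z - wv s = mass s *\<^sub>R (z - y)"
    by (simp_all add: wv_eq lift_diff y_def)
  have "p i (lift s x) - p' i (wv s) - gp i (wv s) \<bullet> (lift s x - wv s)
      \<le> L i / 2 * sqn (lift s x - wv s) + \<delta> i"
    "0 \<le> p i (lift s z) - p' i (wv s) - gp i (wv s) \<bullet> (lift s z - wv s)"
    using p_oracle[OF i'(1)] y unfolding first_order_oracle_def by blast+
  then have "p i (lift s x) - p i (lift s z)
      \<le> mass s * (gp i (wv s) \<bullet> (x - z)) + L i / 2 * ((mass s)\<^sup>2 * sqn (x - y)) + \<delta> i"
    unfolding shift sqn_scale inner_scaleR_right inner_diff_right right_diff_distrib by linarith
  then have "(p i (lift s x) - p i (lift s z)) / mass s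
      \<le> (mass s * (gp i (wv s) \<bullet> (x - z)) + L i / 2 * ((mass s)\<^sup>2 * sqn (x - y)) + \<delta> i) / mass s"
    using mass_pos[of s] by (intro divide_right_mono) auto
  also have "\<dots> = gp i (wv s) \<bullet> (x - z) + L i * mass s / 2 * sqn (x - y) + \<delta> i / mass s"
    using mass_pos[of s] by (simp add: add_divide_distrib power2_eq_square)
  finally have smooth: "(p i (lift s x) - p i (lift s z)) / mass s
      \<le> gp i (wv s) \<bullet> (x - z) + L i * mass s / 2 * sqn (x - y) + \<delta> i / mass s" .
  \<comment> \<open>Monotonicity replaces \<open>Q z\<close> by \<open>Q x\<close>; then \<open>x - z\<close> is split at \<open>w\<close> as in the extragradient method.\<close>
  have mono: "0 \<le> (Q i x - Q i z) \<bullet> (x - z)"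
    using Q_mono[OF i'(1)] x z by (simp add: monotone_operator_def)
  have "wnorm (matrix_inv P) (Q i x - Q i y) \<le> M i * wnorm P (x - y)"
    using Q_lip[OF i'(1)] x y by (simp add: lipschitz_operator_def)
  then have "(wnorm (matrix_inv P) (Q i x - Q i y))\<^sup>2 \<le> (M i)\<^sup>2 * sqn (x - y)"
    unfolding power_mult_distrib[symmetric] by (rule power_mono[OF _ dual_norm(3)])
  then have "(wnorm (matrix_inv P) (Q i x - Q i y))\<^sup>2 / (2 * \<eta> s)
      \<le> (M i)\<^sup>2 * sqn (x - y) / (2 * \<eta> s)"
    using eta by (intro divide_right_mono) auto
  also have "\<dots> \<le> (\<eta> s - L i * mass s) * \<eta> s * sqn (x - y) / (2 * \<eta> s)"
  proof -
    have "0 \<le> L i * mass s" using lm mass_pos[of s] by simp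
    then have "M i * M i \<le> (\<eta> s - L i * mass s) * \<eta> s"
      using lm eta by (intro mult_mono) auto
    then show ?thesis
      using eta by (intro divide_right_mono mult_right_mono) (auto simp: power2_eq_square)
  qed
  also have "\<dots> = (\<eta> s - L i * mass s) / 2 * sqn (x - y)"
    using eta by simp
  finally have "(Q i x - Q i y) \<bullet> (x - w)
      \<le> (\<eta> s - L i * mass s) / 2 * sqn (x - y) + \<eta> s / 2 * sqn (w - x)"
    using dual_young[OF eta(1), of "Q i x - Q i y" "x - w"]
    unfolding sqn_minus_commute[of x w] by linarith
  moreover have "(Q i z - Q i y) \<bullet> (x - z)
      = (Q i x - Q i y) \<bullet> (x - w) + (Q i x - Q i y) \<bullet> (w - z) - (Q i x - Q i z) \<bullet> (x - z)"
    by (simp add: inner_diff_left inner_diff_right)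
  ultimately have "(Q i z - Q i y) \<bullet> (x - z)
      \<le> (\<eta> s - L i * mass s) / 2 * sqn (x - y) + \<eta> s / 2 * (sqn (z - x) - sqn (z - w))"
    using corr mono by (simp add: right_diff_distrib distrib_left)
  then show ?thesis
    using smooth unfolding inner_term_def outer_term_def i[symmetric] y_def[symmetric] w_def[symmetric]
    by (simp add: inner_add_left inner_diff_left distrib_left left_diff_distrib right_diff_distrib
        diff_divide_distrib)
qed

text \<open>
  In the innermost call all levels are frozen, and the gap is the left-hand side of the three-point
  inequality.
\<close>

lemma leaf_bound:
  assumes t: "valid t" "length t = n" "0 < n"
  shows "rec t \<in> Z" and "z \<in> Z \<Longrightarrow> gap t (rec t) z \<le> 0"
proof -
  have pos: "0 < \<eta> (take i t)" if "i \<in> {1..n}" for i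
    using that t by (intro eta_pos valid_take) auto
  have rec: "rec t = arg_min_on (\<lambda>x. \<Sum>i = 1..n.
        (gp i (wv (take i t)) + Q i (zv (take i t))) \<bullet> x
        + 1 / 2 * \<eta> (take i t) * sqn (x - zv (take i t))) Z"
    using t by (simp add: Rec.simps)
  show "rec t \<in> Z"
    unfolding rec using pos t by (intro prox_in Z) auto
  show "gap t (rec t) z \<le> 0" if "z \<in> Z"
  proof -
    have "gap t (rec t) z = (\<Sum>i = 1..n. (gp i (wv (take i t)) + Q i (zv (take i t))) \<bullet> (rec t - z)
        + \<eta> (take i t) / 2 * (sqn (rec t - zv (take i t)) + sqn (z - rec t) - sqn (z - zv (take i t))))"
      using t by (simp add: gap_def outer_term_def min_absorb2)
    also have "\<dots> \<le> 0"
      unfolding rec using pos t that by (intro prox_three_point Z) auto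
    finally show ?thesis .
  qed
qed

text \<open>
  The induction claim for a call. The second clause concerns the iterates that the call leaves behind
  for the next pass of the enclosing loop.
\<close>

definition call_bounded :: "nat list \<Rightarrow> bool" where
  "call_bounded t \<longleftrightarrow> rec t \<in> Z \<and>
     (\<forall>m. length t + m < n \<longrightarrow> zv (t @ [T (Suc (length t))] @ replicate m 0) \<in> Z) \<and>
     (\<forall>z\<in>Z. gap t (rec t) z \<le> (\<Sum>i=Suc (length t)..n.
        coef i t * (dist_at z i t 0 - dist_at z i t (T (Suc (length t)))) + err i t))"

text \<open>
  Extending the multi-index moves exactly the level \<open>length t + 1\<close> from the inner to the outer sum.
\<close>

lemma gap_move_level:
  assumes "length t < n"
  shows "(\<Sum>i=1..length t. outer_term (take i t) x z)
      + (\<Sum>i=Suc (length t)..n. inner_term i (t @ [j]) x z)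
    = gap (t @ [j]) x z - outer_term (t @ [j]) x z + inner_term (Suc (length t)) (t @ [j]) x z"
proof -
  have "(\<Sum>i=1..length t. outer_term (take i (t @ [j])) x z) = (\<Sum>i=1..length t. outer_term (take i t) x z)"
    by (intro sum.cong) auto
  then show ?thesis
    using assms by (simp add: gap_def sum.atLeast_Suc_atMost[of "Suc (length t)" n])
qed

text \<open>
  For the deeper levels, one pass of the loop at \<open>t\<close> is the whole loop of the call at \<open>t @ [j]\<close>; the
  second equation is the transfer step of the algorithm.
\<close>

lemma dist_at_transfer:
  assumes "Suc (length t) < i"
  shows "dist_at z i (t @ [j]) 0 = dist_at z i t j"
    and "dist_at z i (t @ [j]) (T (Suc (length (t @ [j])))) = dist_at z i t (Suc j)"
proof -
  have i: "i - Suc (length t) = Suc (i - Suc (Suc (length t)))" using assms by simp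
  show "dist_at z i (t @ [j]) 0 = dist_at z i t j"
    by (simp add: dist_at_def i)
  show "dist_at z i (t @ [j]) (T (Suc (length (t @ [j])))) = dist_at z i t (Suc j)"
    using zvar.simps(3)[of data t j "i - Suc (Suc (length t))"] by (simp add: dist_at_def i)
qed

lemma iteration_bound:
  assumes t: "valid (t @ [j])" "entry_feasible (t @ [j])" "call_bounded (t @ [j])" and z: "z \<in> Z"
  shows "(\<Sum>i=1..length t. outer_term (take i t) (rec (t @ [j])) z)
      + (\<Sum>i=Suc (length t)..n. inner_term i (t @ [j]) (rec (t @ [j])) z)
    \<le> (\<Sum>i=Suc (length t)..n.
        coef i (t @ [j]) * (dist_at z i t j - dist_at z i t (Suc j)) + err i (t @ [j]))"
proof -
  let ?s = "t @ [j]" and ?k = "Suc (length t)"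
  have k: "length t < n" using t by (simp add: valid_snoc)
  have rec: "rec ?s \<in> Z" using t by (simp add: call_bounded_def)
  have "gap ?s (rec ?s) z \<le> (\<Sum>i=Suc ?k..n.
      coef i ?s * (dist_at z i ?s 0 - dist_at z i ?s (T (Suc (length ?s)))) + err i ?s)"
    using t(3) z by (simp add: call_bounded_def)
  also have "\<dots> = (\<Sum>i=Suc ?k..n. coef i ?s * (dist_at z i t j - dist_at z i t (Suc j)) + err i ?s)"
    by (intro sum.cong refl) (simp add: dist_at_transfer del: length_append)
  finally have deep: "gap ?s (rec ?s) z \<le> \<dots>" .
  have top: "coef ?k ?s = \<eta> ?s / 2" "err ?k ?s = \<delta> ?k / mass ?s"
    "dist_at z ?k t i = sqn (z - zv (t @ [i]))" for i
    using eta_eq[OF t(1)] by (simp_all add: coef_def err_def dist_at_def)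
  have "inner_term ?k ?s (rec ?s) z - outer_term ?s (rec ?s) z
      \<le> coef ?k ?s * (dist_at z ?k t j - dist_at z ?k t (Suc j)) + err ?k ?s"
    unfolding top using inner_le_outer_term[OF t(1) refl _ refl rec t(2) z, of ?k] by simp
  then show ?thesis
    using deep gap_move_level[OF k, of "rec ?s" z j]
    unfolding sum.atLeast_Suc_atMost[OF Suc_leI[OF k]] by linarith
qed

lemma gap_mix:
  assumes t: "valid (t @ [j])" "entry_feasible t" "zb (t @ [j]) \<in> Z" and z: "z \<in> Z"
  shows "gap t (zb (t @ [Suc j])) z \<le> (1 - \<alpha> j) * gap t (zb (t @ [j])) z
    + \<alpha> j * ((\<Sum>i=1..length t. outer_term (take i t) (rec (t @ [j])) z)
      + (\<Sum>i=Suc (length t)..n. inner_term i (t @ [j]) (rec (t @ [j])) z))"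
proof -
  let ?u = "rec (t @ [j])" and ?v = "zb (t @ [j])"
  have "(\<Sum>i=1..length t. outer_term (take i t) (zb (t @ [Suc j])) z)
      \<le> (\<Sum>i=1..length t. \<alpha> j * outer_term (take i t) ?u z + (1 - \<alpha> j) * outer_term (take i t) ?v z)"
    unfolding zbar.simps data_simps using t(1) valid_take
    by (intro sum_mono outer_term_mix) (auto simp: valid_snoc)
  moreover have "(\<Sum>i=Suc (length t)..n. inner_term i t (zb (t @ [Suc j])) z)
      \<le> (\<Sum>i=Suc (length t)..n. \<alpha> j * inner_term i (t @ [j]) ?u z + (1 - \<alpha> j) * inner_term i t ?v z)"
    unfolding zbar.simps data_simps using t z by (intro sum_mono inner_term_mix) auto
  ultimately show ?thesis
    unfolding gap_def by (simp add: sum.distrib distrib_left flip: sum_distrib_left)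
qed

section \<open>Summation over a loop and induction over the levels\<close>

text \<open>
  Up to the factor \<open>\<alpha>\<^sub>j\<^sup>2\<close> required by \<open>accelerated_recursion\<close>, the weights do not depend on \<open>j\<close>. This
  is what dictates the form of the step sizes.
\<close>

lemma coef_snoc:
  assumes "Suc (length t) \<le> i"
  shows "\<alpha> j * coef i (t @ [j]) = (\<alpha> j)\<^sup>2 * (coef i t / (\<alpha> (T (Suc (length t)) - 1))\<^sup>2)"
  using alpha_pos[of "T (Suc (length t)) - 1"]
  by (simp add: coef_def mass_snoc rel_mass_snoc prod.atLeast_Suc_atMost[OF assms] divide_simps
      power2_eq_square) (simp add: algebra_simps)

lemma err_snoc:
  assumes "Suc (length t) \<le> i"
  shows "real (T (Suc (length t))) * (\<alpha> j * err i (t @ [j])) = err i t"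
  using alpha_pos[of j]
  by (simp add: err_def mass_snoc prod.atLeast_Suc_atMost[OF assms])

lemma err_nonneg: "i \<in> {1..n} \<Longrightarrow> 0 \<le> err i t"
  unfolding err_def using delta_nonneg[of i] mass_pos[of t]
  by (intro mult_nonneg_nonneg prod_nonneg divide_nonneg_pos) auto

text \<open>
  Feasibility is propagated along the loop first, since the bounds for the calls inside it are available
  only for feasible data. Then the gap of the running average obeys the accelerated recursion.
\<close>

lemma loop_bound:
  assumes t: "valid t" "length t < n" "entry_feasible t"
    and calls: "\<And>j. j < T (Suc (length t)) \<Longrightarrow> entry_feasible (t @ [j]) \<Longrightarrow> call_bounded (t @ [j])"
  shows "call_bounded t"
proof -
  define k where "k = Suc (length t)"
  have T: "0 < T k" using T_pos[of k] t by (simp add: k_def)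
  have rec: "rec t = zb (t @ [T k])" using t by (simp add: Rec.simps k_def)
  have val: "valid (t @ [j])" if "j < T k" for j
    using that t by (simp add: valid_snoc k_def)
  have entry: "entry_feasible (t @ [j])"
    if "zb (t @ [j]) \<in> Z" "\<And>m. length t + m < n \<Longrightarrow> zv (t @ [j] @ replicate m 0) \<in> Z" for j
    unfolding entry_feasible_def
  proof (intro conjI ballI allI impI)
    fix l assume "l \<in> {1..length (t @ [j])}"
    then consider "l \<in> {1..length t}" | "l = Suc (length t)" by fastforce
    then show "zv (take l (t @ [j])) \<in> Z" "zb (take l (t @ [j])) \<in> Z"
      using that(1) that(2)[of 0] t by (cases; simp add: entry_feasible_def)+
  next
    fix m assume "length (t @ [j]) + m < n"
    then show "zv ((t @ [j]) @ replicate (Suc m) 0) \<in> Z"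
      using that(2)[of "Suc m"] by simp
  qed
  have inv: "zb (t @ [j]) \<in> Z \<and> (\<forall>m. length t + m < n \<longrightarrow> zv (t @ [j] @ replicate m 0) \<in> Z)"
    if "j \<le> T k" for j
    using that
  proof (induction j)
    case 0
    have "zv (t @ [0] @ replicate m 0) \<in> Z" if "length t + m < n" for m
      using t(3) that by (simp add: entry_feasible_def)
    from this this[of 0] show ?case using t(2) by (simp add: zbar.simps)
  next
    case (Suc j)
    then have ok: "entry_feasible (t @ [j])" "zb (t @ [j]) \<in> Z" using entry by auto
    have call: "call_bounded (t @ [j])" using calls[OF _ ok(1)] Suc.prems by (simp add: k_def)
    then have r: "rec (t @ [j]) \<in> Z" by (simp add: call_bounded_def)
    have "zv (t @ [Suc j] @ replicate m 0) \<in> Z" if m: "length t + m < n" for m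
    proof (cases m)
      case 0
      then show ?thesis using correction_step(1)[OF val r] Suc.prems by simp
    next
      case (Suc m')
      have "zv (t @ [Suc j] @ replicate m 0) = zv ((t @ [j]) @ [T (Suc (length (t @ [j])))] @ replicate m' 0)"
        using zvar.simps(3)[of data t j m'] by (simp add: Suc)
      also have "\<dots> \<in> Z" using call m Suc unfolding call_bounded_def by (simp del: append_assoc)
      finally show ?thesis .
    qed
    then show ?case using mix_in[OF r ok(2)] by (simp add: zbar.simps)
  qed
  have call: "entry_feasible (t @ [j])" "call_bounded (t @ [j])" if "j < T k" for j
  proof -
    show "entry_feasible (t @ [j])" using entry inv[of j] that by simp
    then show "call_bounded (t @ [j])" using calls that by (simp add: k_def)
  qed
  have "gap t (rec t) z \<le> (\<Sum>i=k..n. coef i t * (dist_at z i t 0 - dist_at z i t (T k)) + err i t)"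
    if z: "z \<in> Z" for z
  proof -
    define a where "a = (\<alpha> (T k - 1))\<^sup>2"
    define E where "E j = gap t (zb (t @ [j])) z" for j
    define B where "B j = (\<Sum>i=k..n. coef i t / a * dist_at z i t j)" for j
    define e where "e = (\<Sum>i=k..n. err i t) / real (T k)"
    have a: "0 < a" using alpha_pos[of "T k - 1"] by (simp add: a_def)
    have "E (Suc j) \<le> (1 - \<alpha> j) * E j + (\<alpha> j)\<^sup>2 * (B j - B (Suc j)) + e" if j: "j < T k" for j
    proof -
      have summand: "\<alpha> j * (coef i (t @ [j]) * d + err i (t @ [j]))
          = (\<alpha> j)\<^sup>2 * (coef i t / a * d) + err i t / real (T k)" if "i \<in> {k..n}" for i d
      proof -
        have i: "Suc (length t) \<le> i" using that by (simp add: k_def)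
        have "\<alpha> j * (coef i (t @ [j]) * d) = (\<alpha> j)\<^sup>2 * (coef i t / a * d)"
          using coef_snoc[OF i, of j] by (simp add: a_def k_def flip: mult.assoc)
        moreover have "\<alpha> j * err i (t @ [j]) = err i t / real (T k)"
          using err_snoc[OF i, of j] T by (simp add: k_def nonzero_eq_divide_eq mult.commute)
        ultimately show ?thesis by (simp add: distrib_left)
      qed
      have "E (Suc j) \<le> (1 - \<alpha> j) * E j + \<alpha> j * (\<Sum>i=k..n.
          coef i (t @ [j]) * (dist_at z i t j - dist_at z i t (Suc j)) + err i (t @ [j]))"
        unfolding E_def k_def
      proof (rule order_trans[OF gap_mix add_left_mono[OF mult_left_mono[OF iteration_bound]]])
        show "zb (t @ [j]) \<in> Z" using inv[of j] j by simp
        show "0 \<le> \<alpha> j" using alpha_pos[of j] by simp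
      qed (use val[OF j] call[OF j] t(3) z in simp_all)
      also have "\<alpha> j * (\<Sum>i=k..n.
          coef i (t @ [j]) * (dist_at z i t j - dist_at z i t (Suc j)) + err i (t @ [j]))
        = (\<Sum>i=k..n. (\<alpha> j)\<^sup>2 * (coef i t / a * (dist_at z i t j - dist_at z i t (Suc j)))
            + err i t / real (T k))"
        unfolding sum_distrib_left by (intro sum.cong refl summand)
      also have "\<dots> = (\<alpha> j)\<^sup>2 * (B j - B (Suc j)) + e"
        unfolding B_def e_def sum_divide_distrib sum_subtractf[symmetric] sum_distrib_left
          sum.distrib[symmetric] right_diff_distrib ..
      finally show ?thesis by simp
    qed
    moreover have "0 \<le> e"
      unfolding e_def by (intro divide_nonneg_nonneg sum_nonneg err_nonneg) (auto simp: k_def)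
    ultimately have "E (T k) \<le> a * (B 0 - B (T k)) + real (T k) * e"
      unfolding a_def using T by (rule accelerated_recursion)
    also have "a * (B 0 - B (T k)) = (\<Sum>i=k..n. coef i t * (dist_at z i t 0 - dist_at z i t (T k)))"
      using a by (simp add: B_def sum_distrib_left right_diff_distrib flip: sum_subtractf)
    also have "real (T k) * e = (\<Sum>i=k..n. err i t)"
      using T by (simp add: e_def)
    finally show ?thesis by (simp add: E_def rec sum.distrib)
  qed
  then show ?thesis
    using inv[of "T k"] rec unfolding call_bounded_def k_def by simp
qed

lemma call_bound:
  assumes "0 < n" "valid t" "entry_feasible t"
  shows "call_bounded t"
  using assms(2,3)
proof (induction "n - length t" arbitrary: t)
  case 0
  then have "length t = n" by (simp add: valid_def)
  then show ?case using leaf_bound[OF 0(2) _ assms(1)] by (simp add: call_bounded_def)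
next
  case (Suc r)
  then have k: "length t < n" by simp
  show ?case
  proof (rule loop_bound[OF Suc.prems(1) k Suc.prems(2)])
    fix j assume "j < T (Suc (length t))" "entry_feasible (t @ [j])"
    then show "call_bounded (t @ [j])"
      using Suc.hyps(2) Suc.prems(1) k by (intro Suc.hyps(1)) (auto simp: valid_snoc)
  qed
qed

text \<open>
  Only \<open>\<alpha>\<^sub>T\<^sub>-\<^sub>1 \<le> 2/T\<close> enters; the factor \<open>1/2\<close> in \<open>coef\<close> accounts for the exponents \<open>2i - 1\<close> and \<open>i - 1\<close>.
\<close>

lemma coef_Nil_le:
  assumes "i \<in> {1..n}"
  shows "coef i [] \<le> 2 ^ (2 * i - 1) * L i / (\<Prod>j=1..i. (real (T j))\<^sup>2)
    + 2 ^ (i - 1) * M i / (\<Prod>j=1..i. real (T j))"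
proof -
  have lm: "0 \<le> M i" "0 \<le> L i" using LM[OF assms] by auto
  have a: "0 \<le> \<alpha> (T l - 1) \<and> \<alpha> (T l - 1) \<le> 2 / real (T l)" if "l \<in> {1..i}" for l
    using alpha_pos[of "T l - 1"] alpha_le[of "T l"] T_pos[of l] that assms by auto
  have "(\<Prod>l=1..i. \<alpha> (T l - 1)) \<le> (\<Prod>l=1..i. 2 / real (T l))"
    using a by (intro prod_mono)
  then have m: "(\<Prod>l=1..i. \<alpha> (T l - 1)) \<le> 2 ^ i / (\<Prod>j=1..i. real (T j))"
    by (simp add: prod_dividef)
  have "(\<Prod>l=1..i. (\<alpha> (T l - 1))\<^sup>2) \<le> (\<Prod>l=1..i. (2 / real (T l))\<^sup>2)"
    using a by (intro prod_mono) (auto intro: power_mono)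
  then have l: "(\<Prod>l=1..i. (\<alpha> (T l - 1))\<^sup>2) \<le> 2 ^ (2 * i) / (\<Prod>j=1..i. (real (T j))\<^sup>2)"
    by (simp add: prod_dividef power_divide power_mult)
  have "coef i [] = L i * (\<Prod>l=1..i. (\<alpha> (T l - 1))\<^sup>2) / 2 + M i * (\<Prod>l=1..i. \<alpha> (T l - 1)) / 2"
    by (simp add: coef_def)
  also have "\<dots> \<le> L i * (2 ^ (2 * i) / (\<Prod>j=1..i. (real (T j))\<^sup>2)) / 2
      + M i * (2 ^ i / (\<Prod>j=1..i. real (T j))) / 2"
    using l m lm by (intro add_mono divide_right_mono mult_left_mono) auto
  also have "\<dots> = 2 ^ (2 * i - 1) * L i / (\<Prod>j=1..i. (real (T j))\<^sup>2)
    + 2 ^ (i - 1) * M i / (\<Prod>j=1..i. real (T j))"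
  proof -
    obtain r where "i = Suc r" using assms by (cases i) auto
    then show ?thesis by (simp add: mult_ac del: prod.cl_ivl_Suc)
  qed
  finally show ?thesis .
qed

lemma output_bound:
  assumes n: "0 < n" and z: "z \<in> Z"
  shows "(\<Sum>i=1..n. p i (rec []) - p i z + Q i z \<bullet> (rec [] - z))
    \<le> (\<Sum>i=1..n. 2 ^ (2 * i - 1) * L i / (\<Prod>j=1..i. (real (T j))\<^sup>2) * sqn (z_in - z)
        + 2 ^ (i - 1) * M i / (\<Prod>j=1..i. real (T j)) * sqn (z_in - z)
        + \<delta> i * (\<Prod>j=1..i. real (T j)))"
proof -
  have zeros: "zv (replicate m 0) = z_in" for m
    by (simp add: zvar.simps(1))
  have "entry_feasible []"
    unfolding entry_feasible_def using zeros z_in by (auto simp del: replicate_Suc)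
  then have "call_bounded []" using call_bound[OF n valid_Nil] by simp
  then have "gap [] (rec []) z
      \<le> (\<Sum>i=1..n. coef i [] * (dist_at z i [] 0 - dist_at z i [] (T 1)) + err i [])"
    using z by (simp add: call_bounded_def)
  also have "\<dots> \<le> (\<Sum>i=1..n. 2 ^ (2 * i - 1) * L i / (\<Prod>j=1..i. (real (T j))\<^sup>2) * sqn (z_in - z)
        + 2 ^ (i - 1) * M i / (\<Prod>j=1..i. real (T j)) * sqn (z_in - z)
        + \<delta> i * (\<Prod>j=1..i. real (T j)))"
  proof (rule sum_mono)
    fix i assume i: "i \<in> {1..n}"
    have start: "dist_at z i [] 0 = sqn (z_in - z)"
    proof -
      have "dist_at z i [] 0 = sqn (z - zv (replicate (Suc (i - 1)) 0))"
        by (simp add: dist_at_def)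
      then show ?thesis unfolding zeros by (simp add: sqn_minus_commute)
    qed
    have "0 \<le> coef i []"
      unfolding coef_def using LM[OF i] alpha_pos
      by (auto intro!: add_nonneg_nonneg mult_nonneg_nonneg prod_nonneg simp: less_imp_le)
    then have "coef i [] * (dist_at z i [] 0 - dist_at z i [] (T 1)) \<le> coef i [] * sqn (z_in - z)"
      unfolding start by (intro mult_left_mono) (simp_all add: dist_at_def)
    also have "coef i [] * sqn (z_in - z) \<le> (2 ^ (2 * i - 1) * L i / (\<Prod>j=1..i. (real (T j))\<^sup>2)
        + 2 ^ (i - 1) * M i / (\<Prod>j=1..i. real (T j))) * sqn (z_in - z)"
      using coef_Nil_le[OF i] by (intro mult_right_mono) auto
    finally show "coef i [] * (dist_at z i [] 0 - dist_at z i [] (T 1)) + err i []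
      \<le> 2 ^ (2 * i - 1) * L i / (\<Prod>j=1..i. (real (T j))\<^sup>2) * sqn (z_in - z)
        + 2 ^ (i - 1) * M i / (\<Prod>j=1..i. real (T j)) * sqn (z_in - z)
        + \<delta> i * (\<Prod>j=1..i. real (T j))"
      unfolding distrib_right by (simp add: err_def)
  qed
  finally show ?thesis by (simp add: gap_def inner_term_def)
qed

end

theorem theorem3p3:
  fixes P :: "real^'d^'d" and Z :: "(real^'d) set" and n :: nat
    and p p' :: "nat \<Rightarrow> real^'d \<Rightarrow> real" and gp Q :: "nat \<Rightarrow> real^'d \<Rightarrow> real^'d"
    and L M \<delta> :: "nat \<Rightarrow> real" and T :: "nat \<Rightarrow> nat"
    and \<alpha> :: "nat \<Rightarrow> real" and \<eta> :: "nat list \<Rightarrow> real" and z_in z zout :: "real^'d"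
  assumes P: "sym_pos_def P"
    and Z: "Z \<noteq> {}" "closed Z" "convex Z"
    and p_convex: "\<And>i. i \<in> {1..n} \<Longrightarrow> convex_on Z (p i)"
    and Q_cont: "\<And>i. i \<in> {1..n} \<Longrightarrow> continuous_on Z (Q i)"
    and Q_mono: "\<And>i. i \<in> {1..n} \<Longrightarrow> monotone_operator Z (Q i)"
    and LM: "\<And>i. i \<in> {1..n} \<Longrightarrow> 0 \<le> M i \<and> 0 \<le> L i \<and> 0 < M i + L i"
    and Q_lip: "\<And>i. i \<in> {1..n} \<Longrightarrow> lipschitz_operator P Z (M i) (Q i)"
    and p_oracle: "\<And>i. i \<in> {1..n} \<Longrightarrow> first_order_oracle P Z (p i) (p' i) (gp i) (\<delta> i) (L i)"
    and T_pos: "\<And>i. i \<in> {1..n} \<Longrightarrow> 0 < T i"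
    and alpha_0: "\<alpha> 0 = 1"
    and alpha_Suc: "\<And>t. \<alpha> (Suc t) = 2 / (1 + sqrt (1 + 4 / (\<alpha> t)\<^sup>2))"
    and eta: "\<And>k t. k \<in> {1..n} \<Longrightarrow> length t = k \<Longrightarrow> (\<And>l. l \<in> {1..k} \<Longrightarrow> t ! (l - 1) \<le> T l - 1) \<Longrightarrow>
      \<eta> t = L k * (\<Prod>l=1..k. \<alpha> (t ! (l - 1))) + M k * (\<Prod>l=1..k. \<alpha> (t ! (l - 1)) / \<alpha> (T l - 1))"
    and z_in: "z_in \<in> Z"
    and z: "z \<in> Z"
    and zout: "zout = z_out \<lparr>weight = P, feasible = Z, levels = n, grad = gp, oper = Q,
      loops = T, mix = \<alpha>, reg = \<eta>, input = z_in\<rparr>"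
  shows "(\<Sum>i=1..n. p i zout) - (\<Sum>i=1..n. p i z) + (\<Sum>i=1..n. Q i z) \<bullet> (zout - z)
    \<le> (\<Sum>i=1..n. 2 ^ (2 * i - 1) * L i / (\<Prod>j=1..i. (real (T j))\<^sup>2) * (wnorm P (z_in - z))\<^sup>2
           + 2 ^ (i - 1) * M i / (\<Prod>j=1..i. real (T j)) * (wnorm P (z_in - z))\<^sup>2
           + \<delta> i * (\<Prod>j=1..i. real (T j)))"
proof (cases "n = 0")
  case False
  interpret sliding P \<alpha> Z n p p' gp Q L M \<delta> T \<eta> z_in
    using assms by unfold_locales auto
  have "(\<Sum>i=1..n. p i zout) - (\<Sum>i=1..n. p i z) + (\<Sum>i=1..n. Q i z) \<bullet> (zout - z)
      = (\<Sum>i=1..n. p i (rec []) - p i z + Q i z \<bullet> (rec [] - z))"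
    unfolding zout z_out_def data_def by (simp add: sum.distrib sum_subtractf inner_sum_left)
  then show ?thesis using output_bound[OF _ z] False by simp
qed simp

end
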